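(* Let $\mathcal{V}$ be a variety of ai-semirings. If $\mathcal{V}$ is a subvariety of the variety $\mathcal{W}$ and $\mathcal{V}$ contains the three ai-semirings $S_2$, $S_7$ and $S_{53}$, then $\mathcal{V}$ is nonfinitely based.
   Context: An additively idempotent semiring (ai-semiring) is an algebra $(S,+,\cdot)$ with two binary operations (no constants in the signature) such that $(S,+)$ is a commutative idempotent semigroup, $(S,\cdot)$ is a semigroup, and $x(y+z)\approx xy+xz$ and $(x+y)z\approx xz+yz$ hold. Multiplication need not be commutative in general. On an ai-semiring define the partial order $a\leq b \Leftrightarrow a+b=b$. Let $X$ be a countably infinite set of variables. A term is a finite nonempty set of words of the free semigroup $X^+$, written as a formal sum of its elements; terms form the free ai-semiring over $X$. An identity is a formal expression $\mathbf{u}\approx\mathbf{v}$ with $\mathbf{u},\mathbf{v}$ terms; it holds in $S$ if both sides take the same value in $S$ under every assignment of elements of $S$ to the variables. The inequality $\mathbf{u}\preceq\mathbf{v}$ denotes the identity $\mathbf{v}\approx\mathbf{v}+\mathbf{u}$; it holds in $S$ iff the value of $\mathbf{u}$ is $\leq$ the value of $\mathbf{v}$ under every assignment. A variety of ai-semirings is a class of ai-semirings closed under subalgebras, homomorphic images and arbitrary direct products (equivalently, the class of all ai-semirings satisfying some set of identities). A variety is finitely based if it can be defined, within ai-semirings, by a finite set of identities; otherwise it is nonfinitely based. For $n\geq 1$, with pairwise distinct variables $x_1,\dots,x_{2n+1},y_1,y_2$, put $$\mathbf{u}^{(n)} = x_1x_2+x_2x_3+\cdots+x_{2n}x_{2n+1}+x_{2n+1}x_1+y_1y_2+y_2y_1+y_1,\qquad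 \mathbf{q}^{(n)}=y_2 .$$ $\mathcal{W}$ denotes the variety of all ai-semirings satisfying the inequalities $\mathbf{q}^{(n)}\preceq\mathbf{u}^{(n)}$ for all $n\geq 1$. The ai-semirings $S_2$, $S_7$, $S_{53}$ are given by the following Cayley tables. $S_2=\{1,2,3\}$: $$\begin{array}{c|ccc} + & 1&2&3\\ \hline 1&1&1&1\\ 2&1&2&1\\ 3&1&1&3\end{array}\qquad \begin{array}{c|ccc} \cdot & 1&2&3\\ \hline 1&1&1&1\\ 2&1&1&1\\ 3&1&1&2\end{array}$$ $S_7=\{0,a,1\}$: $$\begin{array}{c|ccc} + & 0&a&1\\ \hline 0&0&0&0\\ a&0&a&0\\ 1&0&0&1\end{array}\qquad \begin{array}{c|ccc} \cdot & 0&a&1\\ \hline 0&0&0&0\\ a&0&0&a\\ 1&0&a&1\end{array}$$ $S_{53}=\{1,2,3\}$: $$\begin{array}{c|ccc} + & 1&2&3\\ \hline 1&1&1&3\\ 2&1&2&3\\ 3&3&3&3\end{array}\qquad \begin{array}{c|ccc} \cdot & 1&2&3\\ \hline 1&3&1&3\\ 2&1&2&3\\ 3&3&3&3\end{array}$$ *)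

theory Defs
  imports Main
begin

section \<open>Additively idempotent semirings\<close>

record 'a ais =
  elems :: "'a set"
  sadd :: "'a \<Rightarrow> 'a \<Rightarrow> 'a"
  smul :: "'a \<Rightarrow> 'a \<Rightarrow> 'a"

locale ai_semiring =
  fixes A :: "'a ais"
  assumes nonempty: "elems A \<noteq> {}"
    and add_closed: "\<lbrakk>a \<in> elems A; b \<in> elems A\<rbrakk> \<Longrightarrow> sadd A a b \<in> elems A"
    and mul_closed: "\<lbrakk>a \<in> elems A; b \<in> elems A\<rbrakk> \<Longrightarrow> smul A a b \<in> elems A"
    and add_assoc: "\<lbrakk>a \<in> elems A; b \<in> elems A; c \<in> elems A\<rbrakk>
      \<Longrightarrow> sadd A (sadd A a b) c = sadd A a (sadd A b c)"
    and add_comm: "\<lbrakk>a \<in> elems A; b \<in> elems A\<rbrakk> \<Longrightarrow> sadd A a b = sadd A b a"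
    and add_idem: "a \<in> elems A \<Longrightarrow> sadd A a a = a"
    and mul_assoc: "\<lbrakk>a \<in> elems A; b \<in> elems A; c \<in> elems A\<rbrakk>
      \<Longrightarrow> smul A (smul A a b) c = smul A a (smul A b c)"
    and distrib_left: "\<lbrakk>a \<in> elems A; b \<in> elems A; c \<in> elems A\<rbrakk>
      \<Longrightarrow> smul A a (sadd A b c) = sadd A (smul A a b) (smul A a c)"
    and distrib_right: "\<lbrakk>a \<in> elems A; b \<in> elems A; c \<in> elems A\<rbrakk>
      \<Longrightarrow> smul A (sadd A a b) c = sadd A (smul A a c) (smul A b c)"

definition ais_hom :: "'a ais \<Rightarrow> 'b ais \<Rightarrow> ('a \<Rightarrow> 'b) set" where
  "ais_hom A B = {h. h ` elems A \<subseteq> elems B \<and>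
    (\<forall>a\<in>elems A. \<forall>b\<in>elems A.
      h (sadd A a b) = sadd B (h a) (h b) \<and> h (smul A a b) = smul B (h a) (h b))}"

definition ais_iso :: "'a ais \<Rightarrow> 'b ais \<Rightarrow> bool" where
  "ais_iso A B \<longleftrightarrow> (\<exists>h\<in>ais_hom A B. bij_betw h (elems A) (elems B))"

definition ais_prod :: "'i set \<Rightarrow> ('i \<Rightarrow> 'a ais) \<Rightarrow> ('i \<Rightarrow> 'a) ais" where
  "ais_prod I F =
    \<lparr>elems = {f. (\<forall>i\<in>I. f i \<in> elems (F i)) \<and> (\<forall>i. i \<notin> I \<longrightarrow> f i = undefined)},
     sadd = (\<lambda>f g i. if i \<in> I then sadd (F i) (f i) (g i) else undefined),
     smul = (\<lambda>f g i. if i \<in> I then smul (F i) (f i) (g i) else undefined)\<rparr>"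

section \<open>Terms and identities\<close>

text \<open>The constructors provide the countably infinite set of variables
  x_i = \<open>Xv i\<close>, y_i = \<open>Yv i\<close>.  Terms are finite nonempty sets of nonempty words;
  the sum of two terms is their union.\<close>

datatype var = Xv nat | Yv nat

type_synonym trm = "var list set"

definition is_term :: "trm \<Rightarrow> bool" where
  "is_term t \<longleftrightarrow> finite t \<and> t \<noteq> {} \<and> [] \<notin> t"

fun nefold :: "('a \<Rightarrow> 'a \<Rightarrow> 'a) \<Rightarrow> 'a list \<Rightarrow> 'a" where
  "nefold f [] = undefined"
| "nefold f [a] = a"
| "nefold f (a # b # as) = f a (nefold f (b # as))"

definition word_val :: "'a ais \<Rightarrow> (var \<Rightarrow> 'a) \<Rightarrow> var list \<Rightarrow> 'a" where
  "word_val A \<phi> w = nefold (smul A) (map \<phi> w)"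

text \<open>The words of a term are summed along some enumeration; in an ai-semiring the value
  does not depend on it, see \<open>term_val_eq\<close>.\<close>

definition term_val :: "'a ais \<Rightarrow> (var \<Rightarrow> 'a) \<Rightarrow> trm \<Rightarrow> 'a" where
  "term_val A \<phi> t =
    nefold (sadd A) (map (word_val A \<phi>) (SOME ws. set ws = t \<and> distinct ws))"

definition holds :: "'a ais \<Rightarrow> trm \<times> trm \<Rightarrow> bool" where
  "holds A e \<longleftrightarrow>
    (\<forall>\<phi>. range \<phi> \<subseteq> elems A \<longrightarrow> term_val A \<phi> (fst e) = term_val A \<phi> (snd e))"

definition ineq :: "trm \<Rightarrow> trm \<Rightarrow> trm \<times> trm" where
  "ineq u v = (v, v \<union> u)"

definition models :: "(trm \<times> trm) set \<Rightarrow> 'a ais set" where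
  "models \<Sigma> = {A. ai_semiring A \<and> (\<forall>e\<in>\<Sigma>. holds A e)}"

section \<open>Varieties\<close>

text \<open>Classes of ai-semirings are sets of ai-semirings with elements drawn from a type
  \<open>'a\<close>, to be taken infinite.  As the direct product itself may be too large for \<open>'a\<close>,
  closure under subalgebras and closure under products are combined: every ai-semiring over \<open>'a\<close>
  that embeds into a direct product of members is a member.  Products over index sets larger
  than \<open>'a\<close> yield no further embeddable algebras, since \<open>|'a|\<close> coordinates
  suffice to separate the points of an algebra over \<open>'a\<close>.\<close>

definition variety :: "'a ais set \<Rightarrow> bool" where
  "variety V \<longleftrightarrow>
    (\<forall>A\<in>V. ai_semiring A) \<and>
    (\<forall>A\<in>V. \<forall>B h. ai_semiring B \<and> h \<in> ais_hom A B \<and> h ` elems A = elems B \<longrightarrow> B \<in> V) \<and>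
    (\<forall>(I :: 'a set) F B h. (\<forall>i\<in>I. F i \<in> V) \<and> ai_semiring B \<and>
      h \<in> ais_hom B (ais_prod I F) \<and> inj_on h (elems B) \<longrightarrow> B \<in> V)"

text \<open>Membership of an ai-semiring over an arbitrary type is up to isomorphism.\<close>

definition contains :: "'a ais set \<Rightarrow> 'b ais \<Rightarrow> bool" where
  "contains V S \<longleftrightarrow> (\<exists>A\<in>V. ais_iso A S)"

definition finitely_based :: "'a ais set \<Rightarrow> bool" where
  "finitely_based V \<longleftrightarrow>
    (\<exists>\<Sigma>. finite \<Sigma> \<and> (\<forall>(u, v)\<in>\<Sigma>. is_term u \<and> is_term v) \<and> V = models \<Sigma>)"

definition u_term :: "nat \<Rightarrow> trm" where
  "u_term n = {[Xv i, Xv (i + 1)] | i. 1 \<le> i \<and> i \<le> 2 * n} \<union>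
    {[Xv (2 * n + 1), Xv 1], [Yv 1, Yv 2], [Yv 2, Yv 1], [Yv 1]}"

definition q_term :: "nat \<Rightarrow> trm" where
  "q_term n = {[Yv 2]}"

definition variety_W :: "'a ais set" where
  "variety_W = models {ineq (q_term n) (u_term n) | n. n \<ge> 1}"

section \<open>Three ai-semirings\<close>

text \<open>\<open>cayley es M\<close> is the operation with Cayley table \<open>M\<close>, whose rows and columns are
  labelled by \<open>es\<close>.\<close>

definition cayley :: "'e list \<Rightarrow> 'e list list \<Rightarrow> 'e \<Rightarrow> 'e \<Rightarrow> 'e" where
  "cayley es M a b = the (map_of (zip es (the (map_of (zip es M) a))) b)"

definition S2 :: "nat ais" where
  "S2 = \<lparr>elems = {1, 2, 3},
    sadd = cayley [1, 2, 3]
      [[1, 1, 1],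
       [1, 2, 1],
       [1, 1, 3]],
    smul = cayley [1, 2, 3]
      [[1, 1, 1],
       [1, 1, 1],
       [1, 1, 2]]\<rparr>"

datatype s7 = s7_0 | s7_a | s7_1

definition S7 :: "s7 ais" where
  "S7 = \<lparr>elems = {s7_0, s7_a, s7_1},
    sadd = cayley [s7_0, s7_a, s7_1]
      [[s7_0, s7_0, s7_0],
       [s7_0, s7_a, s7_0],
       [s7_0, s7_0, s7_1]],
    smul = cayley [s7_0, s7_a, s7_1]
      [[s7_0, s7_0, s7_0],
       [s7_0, s7_0, s7_a],
       [s7_0, s7_a, s7_1]]\<rparr>"

definition S53 :: "nat ais" where
  "S53 = \<lparr>elems = {1, 2, 3},
    sadd = cayley [1, 2, 3]
      [[1, 1, 3],
       [1, 2, 3],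
       [3, 3, 3]],
    smul = cayley [1, 2, 3]
      [[3, 1, 3],
       [1, 2, 3],
       [3, 3, 3]]\<rparr>"

section \<open>Basic facts\<close>

lemma cayley3:
  assumes "distinct [p, q, r]"
  shows
    "cayley [p, q, r] [[a, b, c], [d, e, f], [g, h, i]] p p = a"
    "cayley [p, q, r] [[a, b, c], [d, e, f], [g, h, i]] p q = b"
    "cayley [p, q, r] [[a, b, c], [d, e, f], [g, h, i]] p r = c"
    "cayley [p, q, r] [[a, b, c], [d, e, f], [g, h, i]] q p = d"
    "cayley [p, q, r] [[a, b, c], [d, e, f], [g, h, i]] q q = e"
    "cayley [p, q, r] [[a, b, c], [d, e, f], [g, h, i]] q r = f"
    "cayley [p, q, r] [[a, b, c], [d, e, f], [g, h, i]] r p = g"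
    "cayley [p, q, r] [[a, b, c], [d, e, f], [g, h, i]] r q = h"
    "cayley [p, q, r] [[a, b, c], [d, e, f], [g, h, i]] r r = i"
  using assms by (auto simp: cayley_def)

lemma ai_semiring_S2: "ai_semiring S2"
proof -
  let ?C = "elems S2"
  have "?C \<noteq> {}"
    and "\<forall>a\<in>?C. sadd S2 a a = a"
    and "\<forall>a\<in>?C. \<forall>b\<in>?C. sadd S2 a b \<in> ?C \<and> smul S2 a b \<in> ?C \<and>
      sadd S2 a b = sadd S2 b a"
    and "\<forall>a\<in>?C. \<forall>b\<in>?C. \<forall>c\<in>?C.
      sadd S2 (sadd S2 a b) c = sadd S2 a (sadd S2 b c) \<and>
      smul S2 (smul S2 a b) c = smul S2 a (smul S2 b c) \<and>
      smul S2 a (sadd S2 b c) = sadd S2 (smul S2 a b) (smul S2 a c) \<and>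
      smul S2 (sadd S2 a b) c = sadd S2 (smul S2 a c) (smul S2 b c)"
    by (simp_all add: S2_def cayley3)
  then show ?thesis by unfold_locales blast+
qed

lemma ai_semiring_S7: "ai_semiring S7"
proof -
  let ?C = "elems S7"
  have "?C \<noteq> {}"
    and "\<forall>a\<in>?C. sadd S7 a a = a"
    and "\<forall>a\<in>?C. \<forall>b\<in>?C. sadd S7 a b \<in> ?C \<and> smul S7 a b \<in> ?C \<and>
      sadd S7 a b = sadd S7 b a"
    and "\<forall>a\<in>?C. \<forall>b\<in>?C. \<forall>c\<in>?C.
      sadd S7 (sadd S7 a b) c = sadd S7 a (sadd S7 b c) \<and>
      smul S7 (smul S7 a b) c = smul S7 a (smul S7 b c) \<and>
      smul S7 a (sadd S7 b c) = sadd S7 (smul S7 a b) (smul S7 a c) \<and>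
      smul S7 (sadd S7 a b) c = sadd S7 (smul S7 a c) (smul S7 b c)"
    by (simp_all add: S7_def cayley3)
  then show ?thesis by unfold_locales blast+
qed

lemma ai_semiring_S53: "ai_semiring S53"
proof -
  let ?C = "elems S53"
  have "?C \<noteq> {}"
    and "\<forall>a\<in>?C. sadd S53 a a = a"
    and "\<forall>a\<in>?C. \<forall>b\<in>?C. sadd S53 a b \<in> ?C \<and> smul S53 a b \<in> ?C \<and>
      sadd S53 a b = sadd S53 b a"
    and "\<forall>a\<in>?C. \<forall>b\<in>?C. \<forall>c\<in>?C.
      sadd S53 (sadd S53 a b) c = sadd S53 a (sadd S53 b c) \<and>
      smul S53 (smul S53 a b) c = smul S53 a (smul S53 b c) \<and>
      smul S53 a (sadd S53 b c) = sadd S53 (smul S53 a b) (smul S53 a c) \<and>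
      smul S53 (sadd S53 a b) c = sadd S53 (smul S53 a c) (smul S53 b c)"
    by (simp_all add: S53_def cayley3)
  then show ?thesis by unfold_locales blast+
qed

lemma nefold_closed:
  assumes "\<And>a b. \<lbrakk>a \<in> C; b \<in> C\<rbrakk> \<Longrightarrow> f a b \<in> C"
  shows "as \<noteq> [] \<Longrightarrow> set as \<subseteq> C \<Longrightarrow> nefold f as \<in> C"
  using assms by (induction f as rule: nefold.induct) auto

context ai_semiring
begin

lemma word_val_closed:
  assumes "range \<phi> \<subseteq> elems A" "w \<noteq> []"
  shows "word_val A \<phi> w \<in> elems A"
  unfolding word_val_def using assms by (intro nefold_closed) (auto intro: mul_closed)

lemma nefold_add_le_iff:
  "\<lbrakk>as \<noteq> []; set as \<subseteq> elems A; c \<in> elems A\<rbrakk>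
    \<Longrightarrow> sadd A (nefold (sadd A) as) c = c \<longleftrightarrow> (\<forall>a\<in>set as. sadd A a c = c)"
proof (induction as rule: induct_list012)
  case (3 a b as)
  let ?s = "nefold (sadd A) (b # as)"
  have s: "?s \<in> elems A" using 3 by (intro nefold_closed) (auto intro: add_closed)
  have a: "a \<in> elems A" using 3 by auto
  have "sadd A (sadd A a ?s) c = c \<longleftrightarrow> sadd A a c = c \<and> sadd A ?s c = c"
  proof safe
    assume c: "sadd A (sadd A a ?s) c = c"
    have "sadd A a c = sadd A a (sadd A (sadd A a ?s) c)" by (simp add: c)
    also have "\<dots> = sadd A (sadd A (sadd A a a) ?s) c"
      using a s \<open>c \<in> elems A\<close> by (simp add: add_assoc add_closed)
    finally show "sadd A a c = c" using a c by (simp only: add_idem)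
    have "sadd A ?s c = sadd A ?s (sadd A (sadd A ?s a) c)"
      using c a s by (simp add: add_comm[of ?s a])
    also have "\<dots> = sadd A (sadd A (sadd A ?s ?s) a) c"
      using a s \<open>c \<in> elems A\<close> by (simp add: add_assoc add_closed)
    finally show "sadd A ?s c = c" using a s c by (simp add: add_idem add_comm[of ?s a])
  next
    assume "sadd A a c = c" "sadd A ?s c = c"
    then show "sadd A (sadd A a ?s) c = c"
      using a s \<open>c \<in> elems A\<close> by (simp add: add_assoc)
  qed
  then show ?case using 3 by simp
qed auto

lemma nefold_add_cong_set:
  assumes "set as = set bs" "set as \<subseteq> elems A" "as \<noteq> []"
  shows "nefold (sadd A) as = nefold (sadd A) bs"
proof -
  let ?a = "nefold (sadd A) as" and ?b = "nefold (sadd A) bs"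
  have ne: "bs \<noteq> []" using assms by auto
  have a: "?a \<in> elems A" and b: "?b \<in> elems A"
    using assms ne by (auto intro!: nefold_closed intro: add_closed)
  have sub: "set bs \<subseteq> elems A" using assms by simp
  have 1: "\<forall>x\<in>set bs. sadd A x ?b = ?b"
    using nefold_add_le_iff[OF ne sub b] add_idem[OF b] by blast
  have 2: "\<forall>x\<in>set as. sadd A x ?a = ?a"
    using nefold_add_le_iff[OF assms(3,2) a] add_idem[OF a] by blast
  have "sadd A ?a ?b = ?b"
    using nefold_add_le_iff[OF assms(3,2) b] 1 unfolding assms(1) by blast
  moreover have "sadd A ?b ?a = ?a"
    using nefold_add_le_iff[OF ne sub a] 2 unfolding assms(1) by blast
  ultimately show ?thesis using add_comm a b by metis
qed

lemma term_val_eq: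
  assumes "range \<phi> \<subseteq> elems A" "is_term t" "set ws = t"
  shows "term_val A \<phi> t = nefold (sadd A) (map (word_val A \<phi>) ws)"
proof -
  define vs where "vs = (SOME ws. set ws = t \<and> distinct ws)"
  have "\<exists>ws. set ws = t \<and> distinct ws"
    using assms(2) finite_distinct_list unfolding is_term_def by blast
  then have "set vs = t \<and> distinct vs"
    unfolding vs_def by (rule someI_ex)
  then have vs: "set vs = t" ..
  have ne: "map (word_val A \<phi>) vs \<noteq> []"
    using vs assms(2) unfolding is_term_def by auto
  have sub: "set (map (word_val A \<phi>) vs) \<subseteq> elems A"
  proof
    fix a assume "a \<in> set (map (word_val A \<phi>) vs)"
    then obtain w where w: "w \<in> t" "a = word_val A \<phi> w" unfolding set_map vs by blast
    then have "w \<noteq> []" using assms(2) unfolding is_term_def by blast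
    then show "a \<in> elems A" unfolding w(2) by (rule word_val_closed[OF assms(1)])
  qed
  have "set (map (word_val A \<phi>) vs) = set (map (word_val A \<phi>) ws)"
    unfolding set_map vs assms(3) ..
  from nefold_add_cong_set[OF this sub ne] show ?thesis
    unfolding term_val_def vs_def .
qed

end

end

theory Submission
  imports Defs
begin

text \<open>A finite basis of \<open>V\<close> holds in \<open>S7\<close> and \<open>S53\<close> and involves few variables, so
  for large \<open>n\<close> it suffices to find a finite ai-semiring that satisfies every identity of
  \<open>S7\<close> and \<open>S53\<close> in at most \<open>2 * n\<close> variables but not
  \<open>q_term n \<preceq> u_term n\<close>.  View the words of length two in \<open>u_term n\<close> as the edges of a
  graph, an odd cycle of length \<open>2 * n + 1\<close> plus a separate edge.  The elements of the algebra
  are the nonempty vertex sets, an element \<open>Good\<close>, the product of two completely joined vertex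
  sets, and an absorbing \<open>Top\<close>; among the vertex sets only \<open>{Yv 1}\<close> is below \<open>Good\<close>.

  Suppose \<open>w \<preceq> t\<close> holds in both algebras and \<open>t\<close> takes the value \<open>Good\<close>.  By \<open>S53\<close>, any two
  letters of \<open>w\<close> are joined by an edge, so \<open>w\<close> has length at most two as the graph has no
  triangle, and length two is harmless.  If \<open>w\<close> is a single letter, then \<open>t\<close>, having at most
  \<open>2 * n\<close> variables, misses a vertex of the odd cycle, and a bipartition of what remains
  contradicts \<open>S7\<close> unless the letter takes the value \<open>{Yv 1}\<close>.\<close>

section \<open>Evaluation, homomorphisms and isomorphic copies\<close>

lemma nefold_Cons: "as \<noteq> [] \<Longrightarrow> nefold f (a # as) = f a (nefold f as)"
  by (cases as) auto

lemma word_val_single [simp]: "word_val A \<phi> [v] = \<phi> v"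
  by (simp add: word_val_def)

lemma word_val_Cons:
  "w \<noteq> [] \<Longrightarrow> word_val A \<phi> (v # w) = smul A (\<phi> v) (word_val A \<phi> w)"
  by (simp add: word_val_def nefold_Cons)

lemma nefold_hom:
  assumes "\<And>a b. \<lbrakk>a \<in> C; b \<in> C\<rbrakk> \<Longrightarrow> f a b \<in> C"
    and "\<And>a b. \<lbrakk>a \<in> C; b \<in> C\<rbrakk> \<Longrightarrow> h (f a b) = g (h a) (h b)"
  shows "as \<noteq> [] \<Longrightarrow> set as \<subseteq> C \<Longrightarrow> h (nefold f as) = nefold g (map h as)"
proof (induction as rule: induct_list012)
  case (3 a b as)
  have "nefold f (b # as) \<in> C"
    by (rule nefold_closed) (use 3 assms(1) in auto)
  then show ?case using 3 assms(2) by simp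
qed auto

context ai_semiring
begin

lemma hom_word_val:
  assumes "h \<in> ais_hom A B" "range \<phi> \<subseteq> elems A" "w \<noteq> []"
  shows "h (word_val A \<phi> w) = word_val B (h \<circ> \<phi>) w"
proof -
  have "h (nefold (smul A) (map \<phi> w)) = nefold (smul B) (map h (map \<phi> w))"
    by (rule nefold_hom[where C = "elems A"])
      (use assms mul_closed in \<open>auto simp: ais_hom_def\<close>)
  then show ?thesis by (simp add: word_val_def)
qed

lemma term_enum:
  assumes "range \<phi> \<subseteq> elems A" "is_term t"
  obtains ws where "set ws = t" "ws \<noteq> []" "[] \<notin> set ws"
    "set (map (word_val A \<phi>) ws) \<subseteq> elems A"
    "term_val A \<phi> t = nefold (sadd A) (map (word_val A \<phi>) ws)"
proof -
  obtain ws where ws: "set ws = t"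
    using assms(2) finite_list unfolding is_term_def by blast
  have "word_val A \<phi> w \<in> elems A" if "w \<in> set ws" for w
    using that assms(2) by (intro word_val_closed[OF assms(1)]) (auto simp: is_term_def ws)
  then show thesis
    using ws assms(2) by (intro that[OF ws _ _ _ term_val_eq[OF assms ws]]) (auto simp: is_term_def)
qed

lemma hom_term_val:
  assumes B: "ai_semiring B" and h: "h \<in> ais_hom A B"
    and \<phi>: "range \<phi> \<subseteq> elems A" and t: "is_term t"
  shows "h (term_val A \<phi> t) = term_val B (h \<circ> \<phi>) t"
proof -
  obtain ws where ws: "set ws = t" "ws \<noteq> []" "[] \<notin> set ws"
    "set (map (word_val A \<phi>) ws) \<subseteq> elems A"
    "term_val A \<phi> t = nefold (sadd A) (map (word_val A \<phi>) ws)"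
    using term_enum[OF \<phi> t] .
  have "h (nefold (sadd A) (map (word_val A \<phi>) ws))
      = nefold (sadd B) (map h (map (word_val A \<phi>) ws))"
    by (rule nefold_hom[where C = "elems A"])
      (use ws(2,4) h add_closed in \<open>auto simp: ais_hom_def\<close>)
  also have "map h (map (word_val A \<phi>) ws) = map (word_val B (h \<circ> \<phi>)) ws"
    using ws(3) by (auto intro!: hom_word_val[OF h \<phi>])
  also have "nefold (sadd B) \<dots> = term_val B (h \<circ> \<phi>) t"
    by (rule ai_semiring.term_val_eq[OF B _ t ws(1), symmetric])
      (use \<phi> h in \<open>auto simp: ais_hom_def\<close>)
  finally show ?thesis using ws(5) by simp
qed

lemma term_val_closed:
  assumes "range \<phi> \<subseteq> elems A" "is_term t"
  shows "term_val A \<phi> t \<in> elems A"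
proof (rule term_enum[OF assms])
  fix ws
  assume ws: "set ws = t" "ws \<noteq> []" "set (map (word_val A \<phi>) ws) \<subseteq> elems A"
    "term_val A \<phi> t = nefold (sadd A) (map (word_val A \<phi>) ws)"
  show ?thesis
    unfolding ws(4) by (rule nefold_closed) (use ws(2,3) add_closed in auto)
qed

lemma term_val_le_iff:
  assumes "range \<phi> \<subseteq> elems A" "is_term t" "c \<in> elems A"
  shows "sadd A (term_val A \<phi> t) c = c \<longleftrightarrow> (\<forall>s\<in>t. sadd A (word_val A \<phi> s) c = c)"
proof (rule term_enum[OF assms(1,2)])
  fix ws
  assume ws: "set ws = t" "ws \<noteq> []" "set (map (word_val A \<phi>) ws) \<subseteq> elems A"
    "term_val A \<phi> t = nefold (sadd A) (map (word_val A \<phi>) ws)"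
  show ?thesis
    using nefold_add_le_iff[OF _ ws(3) assms(3)] ws(1,2,4) by auto
qed

text \<open>A sum is the least upper bound of its words, so an upper bound \<open>c\<close> of the
  words of \<open>l\<close> also bounds every word of \<open>r\<close>. The identities of
  \<open>S7\<close> and \<open>S53\<close> are exploited in this form.\<close>

lemma holds_le:
  assumes "holds A (l, r)" "is_term l" "is_term r" "range \<phi> \<subseteq> elems A" "c \<in> elems A"
    and "\<And>s. s \<in> l \<Longrightarrow> sadd A (word_val A \<phi> s) c = c" and "w \<in> r"
  shows "sadd A (word_val A \<phi> w) c = c"
  using assms term_val_le_iff[of \<phi> l c] term_val_le_iff[of \<phi> r c]
  by (auto simp: holds_def)

text \<open>An assignment in \<open>B\<close> lifts through \<open>h\<close> to one in
  \<open>A\<close>, and \<open>h\<close> commutes with the evaluation of terms.\<close>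

lemma holds_surj_hom:
  assumes B: "ai_semiring B" and h: "h \<in> ais_hom A B" and surj: "h ` elems A = elems B"
    and e: "is_term (fst e)" "is_term (snd e)" and "holds A e"
  shows "holds B e"
  unfolding holds_def
proof (intro allI impI)
  fix \<psi> :: "var \<Rightarrow> 'b" assume \<psi>: "range \<psi> \<subseteq> elems B"
  define \<phi> where "\<phi> v = inv_into (elems A) h (\<psi> v)" for v
  have \<phi>: "range \<phi> \<subseteq> elems A"
    using \<psi> surj inv_into_into[of _ h "elems A"] by (fastforce simp: \<phi>_def)
  have "h (\<phi> v) = \<psi> v" for v
    unfolding \<phi>_def by (rule f_inv_into_f) (use \<psi> surj in blast)
  then have "\<psi> = h \<circ> \<phi>" by auto
  then show "term_val B \<psi> (fst e) = term_val B \<psi> (snd e)"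
    using hom_term_val[OF B h \<phi>] e \<open>holds A e\<close> \<phi> by (metis holds_def)
qed

end

text \<open>Needed because the model lives on its own type, whereas a variety consists of algebras
  over one fixed type.\<close>

definition copy :: "('a \<Rightarrow> 'b) \<Rightarrow> 'a ais \<Rightarrow> 'b ais" where
  "copy j A = (let g = inv_into (elems A) j in
    \<lparr>elems = j ` elems A, sadd = (\<lambda>a b. j (sadd A (g a) (g b))),
     smul = (\<lambda>a b. j (smul A (g a) (g b)))\<rparr>)"

context ai_semiring
begin

lemma ai_semiring_copy:
  assumes "inj_on j (elems A)"
  shows "ai_semiring (copy j A)"
proof -
  have [simp]: "elems (copy j A) = j ` elems A"
    "a \<in> elems A \<Longrightarrow> b \<in> elems A \<Longrightarrow> sadd (copy j A) (j a) (j b) = j (sadd A a b)"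
    "a \<in> elems A \<Longrightarrow> b \<in> elems A \<Longrightarrow> smul (copy j A) (j a) (j b) = j (smul A a b)" for a b
    using assms by (simp_all add: copy_def Let_def)
  show ?thesis
  proof
    show "elems (copy j A) \<noteq> {}" using nonempty by simp
    fix a b
    assume "a \<in> elems (copy j A)" "b \<in> elems (copy j A)"
    then show "sadd (copy j A) a b = sadd (copy j A) b a"
      by (auto simp: add_comm)
  qed (auto simp: add_closed mul_closed add_idem add_assoc mul_assoc distrib_left distrib_right)
qed

lemma copy_hom:
  assumes "inj_on j (elems A)"
  shows "j \<in> ais_hom A (copy j A)"
    and "inv_into (elems A) j \<in> ais_hom (copy j A) A"
  using assms by (auto simp: ais_hom_def copy_def Let_def add_closed mul_closed)

end

section \<open>Identities of \<open>S7\<close> and \<open>S53\<close>\<close>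

abbreviation occs :: "var set \<Rightarrow> var list \<Rightarrow> nat" where
  "occs Z w \<equiv> length (filter (\<lambda>v. v \<in> Z) w)"

text \<open>In \<open>S53\<close>, 2 is the identity, 3 absorbs and 1 * 1 = 3. So the value counts
  occurrences from \<open>Z\<close> as none, one or too many, a letter outside \<open>C\<close>
  being too many at once.\<close>

lemma S53_word_val:
  assumes "w \<noteq> []"
  shows "word_val S53 (\<lambda>v. if v \<notin> C then 3 else if v \<in> Z then 1 else 2) w =
    (if set w \<subseteq> C \<and> occs Z w = 0 then 2 else if set w \<subseteq> C \<and> occs Z w = 1 then 1 else 3)"
  using assms
proof (induction w)
  case (Cons v w)
  then show ?case
    by (cases "w = []") (auto simp: word_val_Cons S53_def cayley3)
qed simp

text \<open>The additive order of \<open>S53\<close> is 2 < 1 < 3. With \<open>C\<close> the set of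
  letters of \<open>l\<close>, the bound 1 allows one occurrence from \<open>Z\<close> and no new
  letter.\<close>

lemma S53_occs:
  assumes "holds S53 (l, r)" "is_term l" "is_term r" "w \<in> r"
    and "\<And>s. s \<in> l \<Longrightarrow> occs Z s \<le> 1"
  shows "set w \<subseteq> \<Union> (set ` l) \<and> occs Z w \<le> 1"
proof -
  interpret ai_semiring S53 by (rule ai_semiring_S53)
  define \<psi> :: "var \<Rightarrow> nat"
    where "\<psi> = (\<lambda>v. if v \<notin> \<Union> (set ` l) then 3 else if v \<in> Z then 1 else 2)"
  have val: "word_val S53 \<psi> s =
      (if set s \<subseteq> \<Union> (set ` l) \<and> occs Z s = 0 then 2
       else if set s \<subseteq> \<Union> (set ` l) \<and> occs Z s = 1 then 1 else 3)" if "s \<noteq> []" for s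
    unfolding \<psi>_def using that by (rule S53_word_val)
  have "sadd S53 (word_val S53 \<psi> w) 1 = 1"
  proof (rule holds_le[OF assms(1-3)])
    show "range \<psi> \<subseteq> elems S53" "1 \<in> elems S53" by (auto simp: \<psi>_def S53_def)
    fix s assume s: "s \<in> l"
    then have "s \<noteq> []" "set s \<subseteq> \<Union> (set ` l)" "occs Z s = 0 \<or> occs Z s = 1"
      using assms(2) assms(5)[OF s] by (auto simp: is_term_def le_Suc_eq)
    then show "sadd S53 (word_val S53 \<psi> s) 1 = 1"
      unfolding val[OF \<open>s \<noteq> []\<close>] by (auto simp: S53_def cayley3)
  qed (rule assms(4))
  moreover have "w \<noteq> []" using assms(3,4) by (auto simp: is_term_def)
  ultimately show ?thesis
    unfolding val[OF \<open>w \<noteq> []\<close>] by (auto simp: S53_def cayley3 split: if_splits)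
qed

text \<open>\<open>s7_1\<close> is the identity, \<open>s7_0\<close> absorbs and the square of
  \<open>s7_a\<close> is \<open>s7_0\<close>.\<close>

lemma S7_word_val:
  assumes "w \<noteq> []"
  shows "word_val S7 (\<lambda>v. if v \<in> Z then s7_a else s7_1) w =
    (if occs Z w = 0 then s7_1 else if occs Z w = 1 then s7_a else s7_0)"
  using assms
proof (induction w)
  case (Cons v w)
  then show ?case
    by (cases "w = []") (auto simp: word_val_Cons S7_def cayley3)
qed simp

text \<open>Only \<open>s7_a\<close> itself lies below \<open>s7_a\<close>, so here the bound forces
  exactly one occurrence.\<close>

lemma S7_occs:
  assumes "holds S7 (l, r)" "is_term l" "is_term r" "w \<in> r"
    and "\<And>s. s \<in> l \<Longrightarrow> occs Z s = 1"
  shows "occs Z w = 1"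
proof -
  interpret ai_semiring S7 by (rule ai_semiring_S7)
  define \<psi> :: "var \<Rightarrow> s7" where "\<psi> = (\<lambda>v. if v \<in> Z then s7_a else s7_1)"
  have val: "word_val S7 \<psi> s =
      (if occs Z s = 0 then s7_1 else if occs Z s = 1 then s7_a else s7_0)" if "s \<noteq> []" for s
    unfolding \<psi>_def using that by (rule S7_word_val)
  have "sadd S7 (word_val S7 \<psi> w) s7_a = s7_a"
  proof (rule holds_le[OF assms(1-3)])
    show "range \<psi> \<subseteq> elems S7" "s7_a \<in> elems S7" by (auto simp: \<psi>_def S7_def)
    fix s assume s: "s \<in> l"
    then have "s \<noteq> []" using assms(2) by (auto simp: is_term_def)
    then show "sadd S7 (word_val S7 \<psi> s) s7_a = s7_a"
      unfolding val[OF \<open>s \<noteq> []\<close>] assms(5)[OF s] by (simp add: S7_def cayley3)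
  qed (rule assms(4))
  moreover have "w \<noteq> []" using assms(3,4) by (auto simp: is_term_def)
  ultimately show ?thesis
    unfolding val[OF \<open>w \<noteq> []\<close>] by (auto simp: S7_def cayley3 split: if_splits)
qed

section \<open>The graph of \<open>u_term n\<close>\<close>

text \<open>Symmetrised because \<open>u_term n\<close> runs through the odd cycle in one direction
  only.\<close>

definition adj :: "nat \<Rightarrow> var \<Rightarrow> var \<Rightarrow> bool" where
  "adj n a b \<longleftrightarrow> [a, b] \<in> u_term n \<or> [b, a] \<in> u_term n"

definition verts :: "nat \<Rightarrow> var set" where
  "verts n = Xv ` {1..2 * n + 1} \<union> {Yv 1, Yv 2}"

lemma adj_simps [simp]:
  "adj n (Xv i) (Xv j) \<longleftrightarrow> 1 \<le> i \<and> 1 \<le> j \<and> i \<le> 2 * n + 1 \<and> j \<le> 2 * n + 1 \<and>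
    (j = i + 1 \<or> i = j + 1 \<or> i = 1 \<and> j = 2 * n + 1 \<or> j = 1 \<and> i = 2 * n + 1)"
  "\<not> adj n (Xv i) (Yv j)" "\<not> adj n (Yv j) (Xv i)"
  "adj n (Yv i) (Yv j) \<longleftrightarrow> i = 1 \<and> j = 2 \<or> i = 2 \<and> j = 1"
  by (auto simp: adj_def u_term_def)

lemma adj_sym: "adj n a b \<Longrightarrow> adj n b a"
  by (auto simp: adj_def)

text \<open>At \<open>n = 0\<close> the edge that closes the cycle would be a loop at
  \<open>Xv 1\<close>.\<close>

lemma adj_irrefl: "n \<ge> 1 \<Longrightarrow> \<not> adj n a a"
  by (cases a) auto

lemma adj_Yv_1: "adj n (Yv 1) b \<longleftrightarrow> b = Yv 2"
  by (cases b) auto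

lemma adj_Yv_2: "adj n (Yv 2) b \<longleftrightarrow> b = Yv 1"
  by (cases b) auto

text \<open>At \<open>n = 1\<close> the odd cycle is itself a triangle; a longer one contains none.
  On the separate edge, two neighbours of \<open>b\<close> coincide.\<close>

lemma adj_triangle_free:
  assumes "n \<ge> 2" "adj n a b" "adj n b c"
  shows "\<not> adj n a c"
proof (cases b)
  case (Xv j)
  then obtain i k where "a = Xv i" "c = Xv k"
    using assms by (cases a; cases c) simp_all
  then show ?thesis using assms Xv by simp presburger
next
  case (Yv j)
  then have "a = c" using assms by (cases a; cases c) auto
  then show ?thesis using assms(1) adj_irrefl[of n a] by simp
qed

text \<open>A vertex of the odd cycle lies outside \<open>M\<close>, so \<open>M\<close> meets the cycle in a path.\<close>

lemma bipartition_of_small_set: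
  assumes "finite M" "card M \<le> 2 * n" "x \<noteq> Yv 1"
  obtains P where "Yv 1 \<in> P" "x \<notin> P"
    "\<And>a b. \<lbrakk>a \<in> M; b \<in> M; adj n a b\<rbrakk> \<Longrightarrow> a \<in> P \<longleftrightarrow> b \<notin> P"
proof -
  have "\<exists>m\<in>{1..2 * n + 1}. Xv m \<notin> M"
  proof (rule ccontr)
    assume "\<not> ?thesis"
    then have "Xv ` {1..2 * n + 1} \<subseteq> M" by auto
    then have "card (Xv ` {1..2 * n + 1}) \<le> card M" by (rule card_mono[OF assms(1)])
    then show False using assms(2) by (simp add: card_image inj_on_def)
  qed
  then obtain m where m: "1 \<le> m" "m \<le> 2 * n + 1" "Xv m \<notin> M" by auto
  \<comment> \<open>Parity, flipped from \<open>m\<close> on, alternates along edges that avoid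
    \<open>Xv m\<close>: consecutive indices are on the same side of \<open>m\<close>, and the
    closing edge joins two odd indices on opposite sides.\<close>
  define g where "g i \<longleftrightarrow> (even i \<longleftrightarrow> i < m)" for i :: nat
  \<comment> \<open>\<open>c\<close> is the colour of \<open>x\<close> on the cycle;
    \<open>P\<close> takes the opposite colour class there, so that it misses
    \<open>x\<close>.\<close>
  define c where "c \<longleftrightarrow> (\<exists>j. x = Xv j \<and> g j)"
  define P where "P = insert (Yv 1) {Xv i | i. g i \<longleftrightarrow> \<not> c}"
  show thesis
  proof
    show "Yv 1 \<in> P" by (simp add: P_def)
    show "x \<notin> P" using assms(3) by (auto simp: P_def c_def)
    fix a b assume ab: "a \<in> M" "b \<in> M" "adj n a b"
    have P: "Xv i \<in> P \<longleftrightarrow> Xv j \<notin> P" if "a = Xv i" "b = Xv j" for i j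
    proof -
      have "i \<noteq> m" "j \<noteq> m" using ab(1,2) m(3) that by auto
      moreover have "j = i + 1 \<or> i = j + 1 \<or> i = 1 \<and> j = 2 * n + 1 \<or> j = 1 \<and> i = 2 * n + 1"
        using ab(3) that by simp
      ultimately show ?thesis using m(1,2) by (auto simp: P_def g_def)
    qed
    show "a \<in> P \<longleftrightarrow> b \<notin> P"
    proof (cases a; cases b)
      fix i j assume "a = Xv i" "b = Xv j"
      then show ?thesis using P by blast
    qed (use ab(3) in \<open>auto simp: P_def\<close>)
  qed
qed

section \<open>The model\<close>

text \<open>Associativity of the addition fails for the empty vertex set, which is therefore excluded.\<close>

datatype el = Top | Good | Vs "var set"

fun el_add :: "el \<Rightarrow> el \<Rightarrow> el" where
  "el_add (Vs X) (Vs Y) = Vs (X \<union> Y)"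
| "el_add Good Good = Good"
| "el_add Good (Vs X) = (if X = {Yv 1} then Good else Top)"
| "el_add (Vs X) Good = (if X = {Yv 1} then Good else Top)"
| "el_add _ _ = Top"

text \<open>A vertex set is the sum of its singletons and \<open>Top\<close> absorbs in sums, so by
  distributivity a single non-edge spoils the product.\<close>

fun el_mul :: "nat \<Rightarrow> el \<Rightarrow> el \<Rightarrow> el" where
  "el_mul n (Vs X) (Vs Y) = (if \<forall>a\<in>X. \<forall>b\<in>Y. adj n a b then Good else Top)"
| "el_mul n _ _ = Top"

definition graph_ais :: "nat \<Rightarrow> el ais" where
  "graph_ais n = \<lparr>elems = {Top, Good} \<union> Vs ` {X. X \<noteq> {} \<and> X \<subseteq> verts n},
    sadd = el_add, smul = el_mul n\<rparr>"

lemma graph_ais_simps [simp]: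
  "sadd (graph_ais n) = el_add" "smul (graph_ais n) = el_mul n"
  "p \<in> elems (graph_ais n) \<longleftrightarrow>
    p = Top \<or> p = Good \<or> (\<exists>X. p = Vs X \<and> X \<noteq> {} \<and> X \<subseteq> verts n)"
  by (auto simp: graph_ais_def)

lemma finite_graph_ais: "finite (elems (graph_ais n))"
proof -
  have "{X. X \<noteq> {} \<and> X \<subseteq> verts n} \<subseteq> Pow (verts n)" by auto
  then have "finite {X. X \<noteq> {} \<and> X \<subseteq> verts n}"
    by (rule finite_subset) (simp add: verts_def)
  then show ?thesis by (simp add: graph_ais_def)
qed

lemma el_add_Top [simp]: "el_add p Top = Top" "el_add Top p = Top"
  by (cases p; simp)+

lemma el_add_comm: "el_add p q = el_add q p"
  by (cases p; cases q) auto

lemma el_mul_cases: "el_mul n p q = Good \<or> el_mul n p q = Top"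
  by (cases p; cases q) auto

lemma el_mul_Top [simp]: "el_mul n p Top = Top" "el_mul n Top p = Top"
  "el_mul n p Good = Top" "el_mul n Good p = Top"
  by (cases p; simp)+

text \<open>No product is a vertex set, so products of three factors collapse and associativity is
  immediate.\<close>

lemma el_mul_nilpotent [simp]:
  "el_mul n p (el_mul n q r) = Top" "el_mul n (el_mul n p q) r = Top"
  using el_mul_cases[of n q r] el_mul_cases[of n p q] by auto

lemma el_mul_comm: "el_mul n p q = el_mul n q p"
  by (cases p; cases q) (auto dest: adj_sym)

lemma el_mul_distrib: "el_mul n p (el_add q r) = el_add (el_mul n p q) (el_mul n p r)"
  by (cases p; cases q; cases r) auto

lemma el_mul_eq_Good_iff:
  "el_mul n p q = Good \<longleftrightarrow> (\<exists>X Y. p = Vs X \<and> q = Vs Y \<and> (\<forall>a\<in>X. \<forall>b\<in>Y. adj n a b))"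
  by (cases p; cases q) auto

lemma ai_semiring_graph_ais: "ai_semiring (graph_ais n)"
proof
  show "elems (graph_ais n) \<noteq> {}" by (simp add: graph_ais_def)
  fix a b assume a: "a \<in> elems (graph_ais n)" and b: "b \<in> elems (graph_ais n)"
  show "sadd (graph_ais n) a b \<in> elems (graph_ais n)"
    using a b by (cases a; cases b) auto
  show "smul (graph_ais n) a b \<in> elems (graph_ais n)"
    using el_mul_cases[of n a b] by auto
  show "sadd (graph_ais n) a b = sadd (graph_ais n) b a" by (simp add: el_add_comm)
  show "sadd (graph_ais n) a a = a" by (cases a) auto
  fix c assume c: "c \<in> elems (graph_ais n)"
  show "sadd (graph_ais n) (sadd (graph_ais n) a b) c =
      sadd (graph_ais n) a (sadd (graph_ais n) b c)"
    using a b c by (cases a; cases b; cases c) auto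
  show "smul (graph_ais n) a (sadd (graph_ais n) b c) =
      sadd (graph_ais n) (smul (graph_ais n) a b) (smul (graph_ais n) a c)"
    by (simp add: el_mul_distrib)
  show "smul (graph_ais n) (sadd (graph_ais n) a b) c =
      sadd (graph_ais n) (smul (graph_ais n) a c) (smul (graph_ais n) b c)"
    by (simp add: el_mul_distrib el_mul_comm[of n _ c])
  show "smul (graph_ais n) (smul (graph_ais n) a b) c =
      smul (graph_ais n) a (smul (graph_ais n) b c)"
    by simp
qed

section \<open>Small identities hold in the model\<close>

lemma graph_word_val:
  "s \<noteq> [] \<Longrightarrow> (\<exists>v. s = [v]) \<or>
    (\<exists>a b. s = [a, b] \<and> word_val (graph_ais n) \<phi> s = el_mul n (\<phi> a) (\<phi> b)) \<or>
    word_val (graph_ais n) \<phi> s = Top"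
  by (cases s rule: remdups_adj.cases; cases "tl (tl s)") (auto simp: word_val_Cons)

lemma graph_word_le_Good:
  assumes "s \<noteq> []" "el_add (word_val (graph_ais n) \<phi> s) Good = Good"
  obtains v where "s = [v]" "\<phi> v = Good \<or> \<phi> v = Vs {Yv 1}"
  | a b where "s = [a, b]" "el_mul n (\<phi> a) (\<phi> b) = Good"
proof -
  from graph_word_val[OF assms(1), of n \<phi>] consider v where "s = [v]"
    | a b where "s = [a, b]" "word_val (graph_ais n) \<phi> s = el_mul n (\<phi> a) (\<phi> b)"
    | "word_val (graph_ais n) \<phi> s = Top" by blast
  then show thesis
  proof cases
    case (1 v)
    then have "\<phi> v = Good \<or> \<phi> v = Vs {Yv 1}"
      using assms(2) by (cases "\<phi> v") (auto split: if_splits)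
    then show thesis using that(1) 1 by blast
  next
    case (2 a b)
    then show thesis using assms(2) el_mul_cases[of n "\<phi> a" "\<phi> b"] that(2) by auto
  next
    case 3
    then show thesis using assms(2) by simp
  qed
qed

text \<open>A vertex of the set would carry a loop. Membership in the carrier excludes
  \<open>Vs {}\<close>, whose square is vacuously \<open>Good\<close>.\<close>

lemma el_mul_irrefl:
  "\<lbrakk>n \<ge> 1; p \<in> elems (graph_ais n)\<rbrakk> \<Longrightarrow> el_mul n p p \<noteq> Good"
  using adj_irrefl[of n] by (cases p) auto

text \<open>One vertex from each of the three nonempty sets would form a triangle.\<close>

lemma el_mul_triangle_free:
  assumes "n \<ge> 2" "p \<in> elems (graph_ais n)" "q \<in> elems (graph_ais n)" "r \<in> elems (graph_ais n)"
    and "el_mul n p q = Good" "el_mul n q r = Good"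
  shows "el_mul n p r \<noteq> Good"
proof
  assume "el_mul n p r = Good"
  then obtain X Y Z where "p = Vs X" "q = Vs Y" "r = Vs Z"
    and adj: "\<forall>a\<in>X. \<forall>b\<in>Y. adj n a b" "\<forall>a\<in>Y. \<forall>b\<in>Z. adj n a b" "\<forall>a\<in>X. \<forall>b\<in>Z. adj n a b"
    using assms(5,6) by (auto simp: el_mul_eq_Good_iff)
  moreover from this assms(2-4) obtain a b c where "a \<in> X" "b \<in> Y" "c \<in> Z" by auto
  ultimately show False using adj_triangle_free[OF assms(1)] by blast
qed

text \<open>One half of an identity, split by the value of \<open>l\<close>; the other half comes
  from exchanging \<open>l\<close> and \<open>r\<close>.\<close>

lemma graph_ais_word_le:
  assumes n: "n \<ge> 2" and S7: "holds S7 (l, r)" and S53: "holds S53 (l, r)"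
    and l: "is_term l" and r: "is_term r" and small: "card (\<Union> (set ` l)) \<le> 2 * n"
    and \<phi>: "range \<phi> \<subseteq> elems (graph_ais n)" and w: "w \<in> r"
  shows "el_add (word_val (graph_ais n) \<phi> w) (term_val (graph_ais n) \<phi> l)
    = term_val (graph_ais n) \<phi> l"
proof -
  interpret ai_semiring "graph_ais n" by (rule ai_semiring_graph_ais)
  let ?val = "word_val (graph_ais n) \<phi>" and ?p = "term_val (graph_ais n) \<phi> l"
  have p: "?p \<in> elems (graph_ais n)" by (rule term_val_closed[OF \<phi> l])
  have le: "el_add (?val s) ?p = ?p" if "s \<in> l" for s
    using term_val_le_iff[OF \<phi> l p] add_idem[OF p] that by (simp del: graph_ais_simps(3))
  have ne: "s \<noteq> []" if "s \<in> l" for s using l that by (auto simp: is_term_def)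
  have wne: "w \<noteq> []" using r w by (auto simp: is_term_def)
  have occs: "set w \<subseteq> \<Union> (set ` l) \<and> occs Z w \<le> 1" if "\<And>s. s \<in> l \<Longrightarrow> occs Z s \<le> 1" for Z
    using S53_occs[OF S53 l r w that] .
  have el: "\<phi> v \<in> elems (graph_ais n)" for v using \<phi> by blast
  show ?thesis
  proof (cases ?p)
    case Top
    then show ?thesis by simp
  next
    case (Vs Y)
    \<comment> \<open>Longer words take the value \<open>Good\<close> or \<open>Top\<close>, and
      neither lies below a vertex set.\<close>
    have single: "\<exists>v. s = [v]" if "s \<in> l" for s
      using graph_word_val[OF ne[OF that], of n \<phi>] le[OF that] el_mul_cases[of n]
      unfolding Vs by (metis el.distinct(3,5) el_add.simps(3) el_add_Top(2))
    \<comment> \<open>With \<open>Z\<close> the set of all letters of \<open>w\<close>,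
      \<open>occs\<close> is the length of \<open>w\<close>.\<close>
    have "set w \<subseteq> \<Union> (set ` l) \<and> occs (set w) w \<le> 1"
      using single by (intro occs) (force dest: single)
    then have "set w \<subseteq> \<Union> (set ` l)" "length w \<le> 1" by simp_all
    then obtain x where x: "w = [x]" using wne by (cases w) auto
    then obtain s where "s \<in> l" "x \<in> set s" using \<open>set w \<subseteq> _\<close> by auto
    then have "w \<in> l" using single x by fastforce
    then show ?thesis by (rule le)
  next
    case Good
    note shape = graph_word_le_Good[OF ne le[unfolded Good]]
    have sub: "set w \<subseteq> \<Union> (set ` l)" using occs[of "{}"] by simp
    \<comment> \<open>By \<open>S53\<close>, some word of \<open>l\<close> also has two occurrences
      from \<open>{x, z}\<close>. Its shape makes it a product of two joined letters, distinct as
      there are no loops, hence of \<open>x\<close> and \<open>z\<close>.\<close>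
    have pair: "el_mul n (\<phi> x) (\<phi> z) = Good" if two: "occs {x, z} w \<ge> 2" for x z
    proof -
      have "\<exists>s\<in>l. \<not> occs {x, z} s \<le> 1"
      proof (rule ccontr)
        assume "\<not> ?thesis"
        then have "occs {x, z} w \<le> 1" using occs by blast
        then show False using two by linarith
      qed
      then obtain s where s: "s \<in> l" "occs {x, z} s \<ge> 2"
        unfolding not_le by (metis Suc_1 Suc_leI)
      show ?thesis
      proof (rule shape[OF s(1) s(1)])
        fix v assume "s = [v]"
        then show ?thesis using s(2) by (simp split: if_splits)
      next
        fix a b assume ab: "s = [a, b]" "el_mul n (\<phi> a) (\<phi> b) = Good"
        then have "a \<noteq> b" using el_mul_irrefl[OF _ el] n by auto
        moreover have "a \<in> {x, z}" "b \<in> {x, z}" using s(2) ab(1) by (auto split: if_splits)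
        ultimately show ?thesis using ab(2) el_mul_comm[of n] by auto
      qed
    qed
    consider x where "w = [x]" | x z where "w = [x, z]" | x y z v where "w = x # y # z # v"
      using wne by (metis neq_Nil_conv)
    then have "el_add (?val w) Good = Good"
    proof cases
      case (1 x)
      show ?thesis
      proof (cases "w \<in> l")
        case True
        then show ?thesis using le Good by simp
      next
        case False
        obtain s where s: "s \<in> l" "x \<in> set s" using sub 1 by auto
        obtain y where y: "el_mul n (\<phi> x) (\<phi> y) = Good"
        proof (rule shape[OF s(1) s(1)])
          fix v assume "s = [v]"
          then show thesis using s False 1 by simp
        next
          fix a b assume "s = [a, b]" "el_mul n (\<phi> a) (\<phi> b) = Good"
          then show thesis using s(2) that el_mul_comm[of n] by auto
        qed
        then obtain X Y where XY: "\<phi> x = Vs X" "\<phi> y = Vs Y" "\<forall>a\<in>X. \<forall>b\<in>Y. adj n a b"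
          by (auto simp: el_mul_eq_Good_iff)
        have nonempty: "X \<noteq> {}" "Y \<noteq> {}" using XY el[of x] el[of y] by auto
        \<comment> \<open>\<open>f\<close> picks a vertex from each vertex set. The default
          \<open>Yv 1\<close> puts variables of value \<open>Good\<close> on the same side of the
          bipartition as those of value \<open>Vs {Yv 1}\<close>.\<close>
        define f where "f v = (case \<phi> v of Vs X \<Rightarrow> SOME a. a \<in> X | _ \<Rightarrow> Yv 1)" for v
        have f: "f v \<in> U" if "\<phi> v = Vs U" for v U
        proof -
          have "U \<noteq> {}" using el[of v] that by auto
          then show ?thesis unfolding f_def that by (simp add: some_in_eq)
        qed
        have f_adj: "adj n (f a) (f b)" if "el_mul n (\<phi> a) (\<phi> b) = Good" for a b
          using that f by (fastforce simp: el_mul_eq_Good_iff)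
        \<comment> \<open>Otherwise a bipartition of the image of \<open>f\<close> separates
          \<open>Yv 1\<close> from \<open>f x\<close>. Its pullback \<open>Z\<close> meets each word
          of \<open>l\<close> exactly once but misses \<open>x\<close>, against
          \<open>S7\<close>.\<close>
        have "f x = Yv 1"
        proof (rule ccontr)
          assume "f x \<noteq> Yv 1"
          have fin: "finite (\<Union> (set ` l))" using l by (auto simp: is_term_def)
          then have "card (f ` \<Union> (set ` l)) \<le> 2 * n"
            using small card_image_le[OF fin, of f] by linarith
          then obtain P where P: "Yv 1 \<in> P" "f x \<notin> P"
            "\<And>a b. \<lbrakk>a \<in> f ` \<Union> (set ` l); b \<in> f ` \<Union> (set ` l); adj n a b\<rbrakk> \<Longrightarrow> a \<in> P \<longleftrightarrow> b \<notin> P"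
            using bipartition_of_small_set[of "f ` \<Union> (set ` l)" n "f x"] fin \<open>f x \<noteq> Yv 1\<close>
            by blast
          define Z where "Z = {v. f v \<in> P}"
          have Z: "v \<in> Z" if "\<phi> v = Good \<or> \<phi> v = Vs {Yv 1}" for v
            using that P(1) f[of v "{Yv 1}"] by (auto simp: Z_def f_def)
          have "occs Z s = 1" if s: "s \<in> l" for s
          proof (rule shape[OF s s])
            fix v assume "s = [v]" "\<phi> v = Good \<or> \<phi> v = Vs {Yv 1}"
            then show ?thesis using Z by simp
          next
            fix a b assume ab: "s = [a, b]" "el_mul n (\<phi> a) (\<phi> b) = Good"
            then have "f a \<in> P \<longleftrightarrow> f b \<notin> P"
              using s by (intro P(3) f_adj) (auto intro!: imageI)
            then show ?thesis using ab(1) by (auto simp: Z_def)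
          qed
          then have "occs Z w = 1" by (rule S7_occs[OF S7 l r w])
          then show False using 1 P(2) by (simp add: Z_def)
        qed
        \<comment> \<open>\<open>Yv 1\<close> and \<open>Yv 2\<close> are each other's only
          neighbour, which determines first \<open>Y\<close> and then \<open>X\<close>.\<close>
        then have "Yv 1 \<in> X" using f[OF XY(1)] by simp
        then have "Y = {Yv 2}" using XY(3) adj_Yv_1 nonempty by auto
        then have "a = Yv 1" if "a \<in> X" for a
          using XY(3) that adj_Yv_2[of n a] adj_sym by blast
        then have "X = {Yv 1}" using \<open>Yv 1 \<in> X\<close> by blast
        then show ?thesis using 1 XY(1) by simp
      qed
    next
      case (2 x z)
      then have "occs {x, z} w \<ge> 2" by simp
      from pair[OF this] show ?thesis using 2 by (simp add: word_val_Cons)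
    next
      case (3 x y z v)
      then have "el_mul n (\<phi> x) (\<phi> y) = Good" "el_mul n (\<phi> y) (\<phi> z) = Good"
        "el_mul n (\<phi> x) (\<phi> z) = Good" by (auto intro!: pair)
      then show ?thesis using el_mul_triangle_free[OF n el el el] by blast
    qed
    then show ?thesis using Good by simp
  qed
qed

lemma graph_ais_holds:
  assumes n: "n \<ge> 2" and "holds S7 (l, r)" "holds S53 (l, r)" "is_term l" "is_term r"
    and "card (\<Union> (set ` l)) \<le> 2 * n" "card (\<Union> (set ` r)) \<le> 2 * n"
  shows "holds (graph_ais n) (l, r)"
proof -
  interpret ai_semiring "graph_ais n" by (rule ai_semiring_graph_ais)
  have sym: "holds S7 (r, l)" "holds S53 (r, l)" using assms(2,3) by (auto simp: holds_def)
  show ?thesis unfolding holds_def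
  proof (intro allI impI)
    fix \<phi> :: "var \<Rightarrow> el" assume \<phi>: "range \<phi> \<subseteq> elems (graph_ais n)"
    let ?val = "term_val (graph_ais n) \<phi>"
    have "el_add (?val r) (?val l) = ?val l"
      using term_val_le_iff[OF \<phi> assms(5) term_val_closed[OF \<phi> assms(4)]]
        graph_ais_word_le[OF assms(1-6) \<phi>] by (simp del: graph_ais_simps(3))
    moreover have "el_add (?val l) (?val r) = ?val r"
      using term_val_le_iff[OF \<phi> assms(4) term_val_closed[OF \<phi> assms(5)]]
        graph_ais_word_le[OF n sym assms(5,4,7) \<phi>] by (simp del: graph_ais_simps(3))
    ultimately show "?val (fst (l, r)) = ?val (snd (l, r))" by (simp add: el_add_comm)
  qed
qed

section \<open>The inequality that fails in the model\<close>

lemma is_term_u_q: "is_term (u_term n)" "is_term (u_term n \<union> q_term n)"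
proof -
  have "{[Xv i, Xv (i + 1)] | i. 1 \<le> i \<and> i \<le> 2 * n} = (\<lambda>i. [Xv i, Xv (i + 1)]) ` {1..2 * n}"
    by auto
  then have "finite {[Xv i, Xv (i + 1)] | i. 1 \<le> i \<and> i \<le> 2 * n}" by simp
  then show "is_term (u_term n)" "is_term (u_term n \<union> q_term n)"
    unfolding is_term_def u_term_def q_term_def by auto
qed

text \<open>Reading each vertex as its singleton puts every word of \<open>u_term n\<close> below
  \<open>Good\<close>: edges multiply to \<open>Good\<close>, and \<open>Vs {Yv 1}\<close> lies
  below it. \<open>Vs {Yv 2}\<close> does not.\<close>

lemma graph_ais_not_holds: "\<not> holds (graph_ais n) (ineq (q_term n) (u_term n))"
proof
  interpret ai_semiring "graph_ais n" by (rule ai_semiring_graph_ais)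
  define \<phi> where "\<phi> v = (if v \<in> verts n then Vs {v} else Top)" for v
  assume "holds (graph_ais n) (ineq (q_term n) (u_term n))"
  then have holds: "holds (graph_ais n) (u_term n, u_term n \<union> q_term n)"
    by (simp add: ineq_def)
  have "sadd (graph_ais n) (word_val (graph_ais n) \<phi> [Yv 2]) Good = Good"
  proof (rule holds_le[OF holds is_term_u_q])
    show "range \<phi> \<subseteq> elems (graph_ais n)" by (auto simp: \<phi>_def)
    show "Good \<in> elems (graph_ais n)" by simp
    show "[Yv 2] \<in> u_term n \<union> q_term n" by (simp add: q_term_def)
    fix s assume s: "s \<in> u_term n"
    then have "s = [Yv 1] \<or> (\<exists>a\<in>verts n. \<exists>b\<in>verts n. s = [a, b])"
      by (auto simp: u_term_def verts_def)
    then show "sadd (graph_ais n) (word_val (graph_ais n) \<phi> s) Good = Good"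
    proof (elim disjE bexE)
      assume "s = [Yv 1]"
      then show ?thesis by (simp add: \<phi>_def verts_def)
    next
      fix a b assume ab: "a \<in> verts n" "b \<in> verts n" "s = [a, b]"
      then have "adj n a b" using s by (simp add: adj_def)
      then show ?thesis using ab by (simp add: \<phi>_def word_val_Cons)
    qed
  qed
  then show False by (simp add: \<phi>_def verts_def)
qed

section \<open>Transfer to the variety\<close>

lemma contains_models_holds:
  assumes "contains (models \<Sigma> :: 'a ais set) S" "ai_semiring S" "(l, r) \<in> \<Sigma>" "is_term l" "is_term r"
  shows "holds S (l, r)"
proof -
  obtain A :: "'a ais" and h where A: "ai_semiring A" "holds A (l, r)"
    and h: "h \<in> ais_hom A S" "bij_betw h (elems A) (elems S)"
    using assms(1,3) by (auto simp: contains_def models_def ais_iso_def)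
  show ?thesis
    by (rule ai_semiring.holds_surj_hom[OF A(1) assms(2) h(1) _ _ _ A(2)])
      (use h(2) assms(4,5) in \<open>auto simp: bij_betw_def\<close>)
qed

theorem theorem3p5:
  fixes V :: "'a ais set"
  assumes "infinite (UNIV :: 'a set)"
    and "variety V"
    and "V \<subseteq> variety_W"
    and "contains V S2"
    and "contains V S7"
    and "contains V S53"
  shows "\<not> finitely_based V"
proof
  assume "finitely_based V"
  then obtain \<Sigma> where fin: "finite \<Sigma>" and terms: "\<And>l r. (l, r) \<in> \<Sigma> \<Longrightarrow> is_term l \<and> is_term r"
    and V: "V = models \<Sigma>" by (auto simp: finitely_based_def)
  define M where "M = (\<Union>(l, r)\<in>\<Sigma>. \<Union> (set ` (l \<union> r)))"
  have "finite M" using fin terms by (auto simp: M_def is_term_def)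
  \<comment> \<open>Large enough for every identity of the basis to have at most
    \<open>2 * n\<close> variables, and at least 2 to exclude triangles.\<close>
  define n where "n = card M + 2"
  define G where "G = graph_ais n"
  interpret ai_semiring G unfolding G_def by (rule ai_semiring_graph_ais)
  have G_holds: "holds G (l, r)" if lr: "(l, r) \<in> \<Sigma>" for l r
    unfolding G_def
  proof (rule graph_ais_holds)
    have "\<Union> (set ` l) \<subseteq> M" "\<Union> (set ` r) \<subseteq> M" using lr by (force simp: M_def)+
    then have "card (\<Union> (set ` l)) \<le> card M" "card (\<Union> (set ` r)) \<le> card M"
      using card_mono[OF \<open>finite M\<close>] by blast+
    then show "card (\<Union> (set ` l)) \<le> 2 * n" "card (\<Union> (set ` r)) \<le> 2 * n"
      by (simp_all add: n_def)
    show "holds S7 (l, r)" "holds S53 (l, r)"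
      using contains_models_holds assms(5,6) ai_semiring_S7 ai_semiring_S53 lr terms
      unfolding V by blast+
  qed (use lr terms in \<open>auto simp: n_def\<close>)
  \<comment> \<open>The model is finite, so the infinite type \<open>'a\<close> has room for a copy
    of it.\<close>
  obtain B :: "'a set" where "finite B" "card B = card (elems G)"
    using infinite_arbitrarily_large[OF assms(1)] by blast
  then obtain j :: "el \<Rightarrow> 'a" where "bij_betw j (elems G) B"
    using finite_same_card_bij[of "elems G" B] finite_graph_ais by (auto simp: G_def)
  then have j: "inj_on j (elems G)" by (simp add: bij_betw_def)
  have elems: "elems (copy j G) = j ` elems G" by (simp add: copy_def Let_def)
  have copy: "ai_semiring (copy j G)" by (rule ai_semiring_copy[OF j])
  have "holds (copy j G) (l, r)" if "(l, r) \<in> \<Sigma>" for l r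
    by (rule holds_surj_hom[OF copy copy_hom(1)[OF j] elems[symmetric] _ _ G_holds[OF that]])
      (use terms[OF that] in auto)
  then have "copy j G \<in> V" using copy by (auto simp: V models_def)
  then have "copy j G \<in> variety_W" using assms(3) by blast
  then have W: "holds (copy j G) (ineq (q_term n) (u_term n))"
    unfolding variety_W_def models_def by (auto simp: n_def simp del: split_paired_All)
  \<comment> \<open>The inequality returns from the copy to the model along the inverse of
    \<open>j\<close>.\<close>
  have "holds G (ineq (q_term n) (u_term n))"
    by (rule ai_semiring.holds_surj_hom[OF copy ai_semiring_axioms copy_hom(2)[OF j] _ _ _ W])
      (use j is_term_u_q in \<open>auto simp: elems ineq_def\<close>)
  then show False using graph_ais_not_holds by (simp add: G_def)
qed

end
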